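(* $\mathcal{A}(\mathbb{R})$ is cyclically involutive.
   Context: $\mathcal{A}(\mathcal{H})$ denotes the set of proper, lower-semicontinuous, convex functions $\mathcal{H}\to\mathbb{R}\cup\{+\infty\}$ on a real Hilbert space $\mathcal{H}$ (here $\mathcal{H}=\mathbb{R}$). For $N\ge 2$, $c(x_1,\dots,x_N)=\sum_{1\le i<j\le N}\langle x_i,x_j\rangle$ on $\mathcal{H}^N$. For proper functions $f_1,\dots,f_N$ on $\mathcal{H}$ and $1\le i\le N$, $$\Big(\bigoplus_{j\ne i}f_j\Big)^c(x_i):=\sup_{x_j\in\mathcal{H},\ j\ne i}\Big(c(x_1,\dots,x_N)-\sum_{j\ne i}f_j(x_j)\Big).$$ A subset $\Omega\subseteq\mathcal{A}(\mathcal{H})$ is $N$-cyclically involutive if for any $f_1,\dots,f_N\in\Omega$ satisfying $f_i(x_i)=\big(\bigoplus_{j\ne i}f_j\big)^c(x_i)$ for all $x_i\in\mathcal{H}$ and every $i=2,\dots,N$, one also has $f_1(x_1)=\big(\bigoplus_{j\ne 1}f_j\big)^c(x_1)$ for all $x_1\in\mathcal{H}$. $\Omega$ is cyclically involutive if it is $N$-cyclically involutive for every $N\ge 2$. *)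

theory Defs
  imports "HOL-Analysis.Analysis"
begin

text \<open>
  Real Hilbert spaces are types of sort \<open>{real_inner, complete_space}\<close>, and functions with
  values in \<open>\<real> \<union> {+\<infinity>}\<close> are \<^typ>\<open>ereal\<close>-valued functions that never take the value \<open>-\<infinity>\<close>.
\<close>

definition proper_fun :: "('a \<Rightarrow> ereal) \<Rightarrow> bool" where
  "proper_fun f \<longleftrightarrow> (\<forall>x. f x \<noteq> -\<infinity>) \<and> (\<exists>x. f x \<noteq> \<infinity>)"

definition lower_semicontinuous :: "('a::topological_space \<Rightarrow> ereal) \<Rightarrow> bool" where
  "lower_semicontinuous f \<longleftrightarrow> (\<forall>x. f x \<le> Liminf (at x) f)"

text \<open>
  As \<open>0 * \<infinity> = 0\<close> in \<^typ>\<open>ereal\<close>, the end points \<open>u = 0\<close> and \<open>u = 1\<close> impose no condition.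
\<close>

definition convex_fun :: "('a::real_vector \<Rightarrow> ereal) \<Rightarrow> bool" where
  "convex_fun f \<longleftrightarrow> (\<forall>x y. \<forall>u\<ge>0. \<forall>v\<ge>0. u + v = 1 \<longrightarrow>
     f (u *\<^sub>R x + v *\<^sub>R y) \<le> ereal u * f x + ereal v * f y)"

definition lsc_convex_funs :: "('a::{real_inner, complete_space} \<Rightarrow> ereal) set" where
  "lsc_convex_funs = {f. proper_fun f \<and> lower_semicontinuous f \<and> convex_fun f}"

text \<open>
  A point \<open>(x\<^sub>1, \<dots>, x\<^sub>N)\<close> of the \<open>N\<close>-fold product and a family \<open>f\<^sub>1, \<dots>, f\<^sub>N\<close> are functions
  on \<^typ>\<open>nat\<close>, of which only the values at the indices \<open>1, \<dots>, N\<close> are ever read.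
\<close>

definition mm_cost :: "nat \<Rightarrow> (nat \<Rightarrow> 'a::real_inner) \<Rightarrow> real" where
  "mm_cost N x = (\<Sum>(i, j) \<in> {(i, j). 1 \<le> i \<and> i < j \<and> j \<le> N}. x i \<bullet> x j)"

text \<open>
  In the supremum the \<open>i\<close>-th coordinate is fixed to \<open>t\<close> and all the others vary freely. For
  proper \<open>f\<^sub>j\<close> the subtracted sum is never \<open>-\<infinity>\<close>, so each term is a genuine element of
  \<open>\<real> \<union> {-\<infinity>}\<close>.
\<close>

definition c_conj_except :: "nat \<Rightarrow> (nat \<Rightarrow> 'a::real_inner \<Rightarrow> ereal) \<Rightarrow> nat \<Rightarrow> 'a \<Rightarrow> ereal" where
  "c_conj_except N f i t =
     (SUP x \<in> {x. x i = t}. ereal (mm_cost N x) - (\<Sum>j\<in>{1..N} - {i}. f j (x j)))"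

definition N_cyclically_involutive ::
    "nat \<Rightarrow> ('a::{real_inner, complete_space} \<Rightarrow> ereal) set \<Rightarrow> bool" where
  "N_cyclically_involutive N \<Omega> \<longleftrightarrow>
     (\<forall>f. (\<forall>i\<in>{1..N}. f i \<in> \<Omega>) \<longrightarrow>
          (\<forall>i\<in>{2..N}. \<forall>t. f i t = c_conj_except N f i t) \<longrightarrow>
          (\<forall>t. f 1 t = c_conj_except N f 1 t))"

definition cyclically_involutive ::
    "('a::{real_inner, complete_space} \<Rightarrow> ereal) set \<Rightarrow> bool" where
  "cyclically_involutive \<Omega> \<longleftrightarrow> (\<forall>N\<ge>2. N_cyclically_involutive N \<Omega>)"

end

theory Submission
  imports Defs
begin

text \<open>
  Put \<open>q s = s\<^sup>2 / 2\<close> and \<open>Q\<^sub>i = (f\<^sub>i + q)\<^sup>*\<close>, the Fenchel conjugate. On the real line the cost is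
  \<open>q (x\<^sub>1 + \<dots> + x\<^sub>N) - q x\<^sub>1 - \<dots> - q x\<^sub>N\<close>, so statements about the multi-marginal conjugates turn
  into statements about the finite convex functions \<open>Q\<^sub>i\<close> of one variable, the sum of the
  coordinates:

  \<^item> a single one of the conjugacy equations gives \<open>c (x\<^sub>1, \<dots>, x\<^sub>N) \<le> f\<^sub>1 x\<^sub>1 + \<dots> + f\<^sub>N x\<^sub>N\<close>, that is
    \<open>\<phi> := q - (Q\<^sub>1 + \<dots> + Q\<^sub>N) \<ge> 0\<close>;
  \<^item> the equation for the index \<open>j\<close> gives that every affine minorant of \<open>Q\<^sub>j + \<phi>\<close> is a minorant of
    \<open>Q\<^sub>j\<close>;
  \<^item> conversely, if \<open>\<phi> = 0\<close>, then \<open>f\<^sub>1\<close> is conjugate to the others, by the Fenchel--Moreau theorem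
    for \<open>f\<^sub>1\<close>.

  The heart of the proof is that \<open>\<phi>\<close> vanishes (\<open>gap_vanishes\<close>), and here the dimension matters.
  On an interval where \<open>\<phi> > 0\<close> the functions \<open>Q\<^sub>j\<close> with \<open>j \<ge> 2\<close> are affine: otherwise \<open>Q\<^sub>j\<close> lies
  strictly below its chord somewhere, and an affine function parallel to the chord fits below
  \<open>Q\<^sub>j + \<phi>\<close> but not below \<open>Q\<^sub>j\<close> (\<open>affine_where_gap_positive\<close>). As \<open>q - Q\<^sub>1\<close>, the Moreau envelope
  of \<open>f\<^sub>1\<close>, is convex, \<open>\<phi>\<close> is convex on each component of \<open>{\<phi> > 0}\<close>. A tangent of \<open>\<phi>\<close> at a
  point of that component is nonpositive from the end points of the component onwards, hence is a
  minorant of \<open>\<phi>\<close> on the whole line. Adding it to a tangent of \<open>Q\<^sub>j\<close> at the same point gives an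
  affine minorant of \<open>Q\<^sub>j + \<phi>\<close> which is not a minorant of \<open>Q\<^sub>j\<close>.
\<close>

section \<open>The vanishing of the gap\<close>

text \<open>
  The hypothesis \<open>minor\<close> says that \<open>G\<close> is the largest convex minorant of \<open>G + \<phi>\<close>.
\<close>

lemma affine_where_gap_positive:
  fixes G \<phi> :: "real \<Rightarrow> real"
  assumes G: "convex_on UNIV G" and cont: "continuous_on UNIV \<phi>"
    and nonneg: "\<And>s. 0 \<le> \<phi> s"
    and minor: "\<And>m k. (\<And>s. m * s + k \<le> G s + \<phi> s) \<Longrightarrow> (\<And>s. m * s + k \<le> G s)"
    and ab: "a < b" and pos: "\<And>s. s \<in> {a..b} \<Longrightarrow> \<phi> s > 0"
  shows "\<exists>m k. \<forall>s\<in>{a..b}. G s = m * s + k"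
proof -
  \<comment> \<open>\<open>m * s + k\<close> is the chord of \<open>G\<close> over \<open>{a..b}\<close>, and \<open>d\<close> its largest height above \<open>G\<close>.\<close>
  define m where "m = (G b - G a) / (b - a)"
  define k where "k = G a - m * a"
  have "m * (b - a) = G b - G a" using ab by (simp add: m_def)
  then have La: "m * a + k = G a" and Lb: "m * b + k = G b"
    by (auto simp: k_def algebra_simps)
  have inside: "G s \<le> m * s + k" if "s \<in> {a..b}" for s
  proof -
    define u where "u = (s - a) / (b - a)"
    have u: "0 \<le> u" "u \<le> 1" using that ab by (auto simp: u_def)
    have "u * (b - a) = s - a" using ab by (simp add: u_def)
    then have s: "s = (1 - u) * a + u * b" by (simp add: algebra_simps)
    have "G s \<le> (1 - u) * G a + u * G b"
      using convex_onD[OF G u] s by simp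
    also have "\<dots> = m * s + k"
      unfolding s La[symmetric] Lb[symmetric] by (simp add: algebra_simps)
    finally show ?thesis .
  qed
  have outside: "m * s + k \<le> G s" if "s \<notin> {a..b}" for s
  proof -
    from that have "s < a \<or> b < s" by auto
    then show ?thesis
    proof
      assume 1: "s < a"
      define u where "u = (a - s) / (b - s)"
      have u: "0 \<le> u" "u < 1" using 1 ab by (auto simp: u_def)
      have "u * (b - s) = a - s" using 1 ab by (simp add: u_def)
      then have a: "a = (1 - u) * s + u * b" by (simp add: algebra_simps)
      have "G a \<le> (1 - u) * G s + u * G b"
        using convex_onD[OF G u(1)] u a by simp
      moreover have "m * a + k = (1 - u) * (m * s + k) + u * (m * b + k)"
        by (subst a) (simp add: algebra_simps)
      ultimately have "(1 - u) * (m * s + k) \<le> (1 - u) * G s"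
        unfolding La Lb by linarith
      then show ?thesis using u by simp
    next
      assume 2: "b < s"
      define u where "u = (s - b) / (s - a)"
      have u: "0 \<le> u" "u < 1" using 2 ab by (auto simp: u_def)
      have "u * (s - a) = s - b" using 2 ab by (simp add: u_def)
      then have b: "b = (1 - u) * s + u * a" by (simp add: algebra_simps)
      have "G b \<le> (1 - u) * G s + u * G a"
        using convex_onD[OF G u(1)] u b by simp
      moreover have "m * b + k = (1 - u) * (m * s + k) + u * (m * a + k)"
        by (subst b) (simp add: algebra_simps)
      ultimately have "(1 - u) * (m * s + k) \<le> (1 - u) * G s"
        unfolding La Lb by linarith
      then show ?thesis using u by simp
    qed
  qed
  have contG: "continuous_on UNIV G"
    using convex_on_continuous[OF _ G] by simp
  have ne: "{a..b} \<noteq> {}" using ab by simp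
  have "continuous_on {a..b} (\<lambda>s. m * s + k - G s)"
    by (intro continuous_intros continuous_on_subset[OF contG]) auto
  from continuous_attains_sup[OF compact_Icc ne this] obtain t
    where t: "t \<in> {a..b}" "\<And>s. s \<in> {a..b} \<Longrightarrow> m * s + k - G s \<le> m * t + k - G t" by blast
  obtain w where w: "w \<in> {a..b}" "\<And>s. s \<in> {a..b} \<Longrightarrow> \<phi> w \<le> \<phi> s"
    using continuous_attains_inf[OF compact_Icc ne continuous_on_subset[OF cont subset_UNIV]] by blast
  define d where "d = m * t + k - G t"
  have "d \<le> 0"
  proof (rule ccontr)
    assume "\<not> d \<le> 0"
    \<comment> \<open>The chord lowered by \<open>d\<close> touches \<open>G\<close> from below at \<open>t\<close>; it may be raised again by \<open>\<eta>\<close>,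
        as it then still lies below \<open>G + \<phi>\<close> inside \<open>{a..b}\<close> and below the chord outside.\<close>
    define \<eta> where "\<eta> = min d (\<phi> w)"
    have \<eta>: "0 < \<eta>" "\<eta> \<le> d" "\<eta> \<le> \<phi> w" using \<open>\<not> d \<le> 0\<close> pos[OF w(1)] by (auto simp: \<eta>_def)
    have "m * s + (k - d + \<eta>) \<le> G s + \<phi> s" for s
    proof (cases "s \<in> {a..b}")
      case True
      then show ?thesis using t(2)[OF True] w(2)[OF True] \<eta> by (simp add: d_def)
    next
      case False
      then show ?thesis using outside[OF False] nonneg[of s] \<eta> by simp
    qed
    then have "m * t + (k - d + \<eta>) \<le> G t" by (rule minor)
    then show False using \<eta> by (simp add: d_def)
  qed
  then have "G s = m * s + k" if "s \<in> {a..b}" for s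
    using t(2)[OF that] inside[OF that] by (simp add: d_def)
  then show ?thesis by blast
qed


text \<open>
  The dimension enters through the order of the line: a tangent of the gap \<open>\<phi>\<close> on a component of
  \<open>{\<phi> > 0}\<close> has dropped to \<open>0\<close> or below at each end point, hence beyond it as well.
\<close>

lemma gap_vanishes:
  fixes E :: "real \<Rightarrow> real" and G :: "'i \<Rightarrow> real \<Rightarrow> real"
  assumes E: "convex_on UNIV E" and J: "finite J" "J \<noteq> {}"
    and G: "\<And>j. j \<in> J \<Longrightarrow> convex_on UNIV (G j)"
    and le: "\<And>s. (\<Sum>j\<in>J. G j s) \<le> E s"
    and minor: "\<And>j m k. j \<in> J \<Longrightarrow> (\<And>s. m * s + k \<le> G j s + (E s - (\<Sum>j\<in>J. G j s)))
                  \<Longrightarrow> (\<And>s. m * s + k \<le> G j s)"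
  shows "E s0 = (\<Sum>j\<in>J. G j s0)"
proof (rule ccontr)
  define \<phi> where "\<phi> s = E s - (\<Sum>j\<in>J. G j s)" for s
  assume "E s0 \<noteq> (\<Sum>j\<in>J. G j s0)"
  then have pos0: "\<phi> s0 > 0" using le[of s0] by (simp add: \<phi>_def)
  have nonneg: "0 \<le> \<phi> s" for s using le[of s] by (simp add: \<phi>_def)
  have cont: "continuous_on UNIV \<phi>"
    unfolding \<phi>_def using convex_on_continuous[OF _ E] convex_on_continuous[OF _ G]
    by (intro continuous_intros) auto
  \<comment> \<open>\<open>I\<close> is the connected component of \<open>s0\<close> in \<open>{\<phi> > 0}\<close>.\<close>
  define I where "I = {t. \<forall>s\<in>closed_segment s0 t. \<phi> s > 0}"
  have cvxI: "convex I"
    unfolding is_interval_convex_1[symmetric] is_interval_1 I_def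
    by (auto simp: closed_segment_eq_real_ivl split: if_splits)
  have posI: "\<phi> s > 0" if "s \<in> I" for s using that by (auto simp: I_def)
  have intI: "s0 \<in> interior I"
  proof -
    have "open {s. \<phi> s > 0}"
      using open_Collect_less[OF continuous_on_const cont] by simp
    then obtain e where e: "e > 0" "ball s0 e \<subseteq> {s. \<phi> s > 0}"
      using pos0 by (auto elim!: openE)
    have "ball s0 e \<subseteq> I"
    proof
      fix t assume "t \<in> ball s0 e"
      then have "closed_segment s0 t \<subseteq> ball s0 e"
        using e by (intro closed_segment_subset) auto
      then show "t \<in> I" using e by (auto simp: I_def)
    qed
    then show ?thesis using e(1) by (meson centre_in_ball interior_maximal open_ball subsetD)
  qed
  have "convex_on I \<phi>"
  proof (rule convex_on_linorderI[OF _ cvxI])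
    fix u a b :: real
    assume u: "0 < u" "u < 1" and ab: "a \<in> I" "b \<in> I" "a < b"
    have sub: "{a..b} \<subseteq> I"
      using cvxI ab by (metis closed_segment_eq_real_ivl closed_segment_subset less_imp_le)
    have "\<forall>j\<in>J. \<exists>m k. \<forall>s\<in>{a..b}. G j s = m * s + k"
      using affine_where_gap_positive[OF G cont nonneg minor[folded \<phi>_def] ab(3)] sub posI by blast
    then obtain m k where mk: "\<And>j s. j \<in> J \<Longrightarrow> s \<in> {a..b} \<Longrightarrow> G j s = m j * s + k j"
      by metis
    define M where "M = (\<Sum>j\<in>J. m j)"
    define K where "K = (\<Sum>j\<in>J. k j)"
    have \<phi>: "\<phi> s = E s - (M * s + K)" if "s \<in> {a..b}" for s
      using mk[OF _ that] by (simp add: \<phi>_def M_def K_def sum.distrib sum_distrib_right)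
    define w where "w = (1 - u) * a + u * b"
    have "w \<in> {a..b}"
      using convexD_alt[OF convex_real_interval(5), of a a b b u] u ab by (simp add: w_def)
    moreover have "E w \<le> (1 - u) * E a + u * E b"
      using convex_onD[OF E, of u a b] u by (simp add: w_def)
    ultimately have "\<phi> w \<le> (1 - u) * \<phi> a + u * \<phi> b"
      using ab(3) by (simp add: \<phi>) (simp add: w_def algebra_simps)
    then show "\<phi> ((1 - u) *\<^sub>R a + u *\<^sub>R b) \<le> (1 - u) * \<phi> a + u * \<phi> b"
      by (simp add: w_def)
  qed
  from convex_le_Inf_differential[OF this intI] obtain p
    where p: "\<And>t. t \<in> I \<Longrightarrow> \<phi> s0 + p * (t - s0) \<le> \<phi> t" by metis
  have tangent: "\<phi> s0 + p * (t - s0) \<le> \<phi> t" for t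
  proof (cases "t \<in> I")
    case False
    \<comment> \<open>Let \<open>h v\<close> be the first zero of \<open>\<phi>\<close> on the way from \<open>s0\<close> to \<open>t\<close>. The tangent is at most
        \<open>0\<close> there and positive at \<open>s0\<close>, hence at most \<open>0\<close> at \<open>t\<close>.\<close>
    define h where "h v = s0 + v * (t - s0)" for v
    define Z where "Z = {v \<in> {0..1}. \<phi> (h v) \<le> 0}"
    have conth: "continuous_on UNIV (\<lambda>v. \<phi> (h v))"
      unfolding h_def by (rule continuous_on_compose2[OF cont]) (auto intro!: continuous_intros)
    have "Z = {0..1} \<inter> {v. \<phi> (h v) \<le> 0}" by (auto simp: Z_def)
    then have "compact Z"
      using closed_Collect_le[OF conth continuous_on_const, of 0] by (simp add: compact_Int_closed)
    moreover have "Z \<noteq> {}"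
    proof -
      obtain s where "s \<in> closed_segment s0 t" "\<phi> s \<le> 0"
        using False by (force simp: I_def not_less)
      then obtain v where "0 \<le> v" "v \<le> 1" "s = (1 - v) * s0 + v * t"
        by (auto simp: closed_segment_def)
      moreover from this have "s = h v" by (simp add: h_def algebra_simps)
      ultimately have "v \<in> Z" using \<open>\<phi> s \<le> 0\<close> by (simp add: Z_def)
      then show ?thesis by blast
    qed
    ultimately obtain v where v: "v \<in> Z" "\<And>w. w \<in> Z \<Longrightarrow> v \<le> w"
      using compact_attains_inf[of Z] by metis
    have "v \<noteq> 0" using v(1) pos0 by (auto simp: Z_def h_def)
    then have v01: "0 < v" "v \<le> 1" using v(1) by (auto simp: Z_def)
    have "h w \<in> I" if "0 \<le> w" "w < v" for w
    proof -
      have "\<phi> s > 0" if s: "s \<in> closed_segment s0 (h w)" for s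
      proof (rule ccontr)
        obtain x where x: "0 \<le> x" "x \<le> 1" "s = (1 - x) * s0 + x * h w"
          using s by (auto simp: closed_segment_def)
        have xw: "x * w \<le> w" using x that \<open>0 \<le> w\<close> by (simp add: mult_left_le_one_le)
        have "s = h (x * w)" using x by (simp add: h_def algebra_simps)
        moreover assume "\<not> \<phi> s > 0"
        ultimately have "x * w \<in> Z"
          using x \<open>0 \<le> w\<close> \<open>w < v\<close> v01 xw by (simp add: Z_def)
        then show False using v(2) xw \<open>w < v\<close> by force
      qed
      then show ?thesis by (simp add: I_def)
    qed
    then have below: "\<phi> s0 + p * (h w - s0) - \<phi> (h w) \<le> 0" if "w \<in> {0..<v}" for w
      using p[of "h w"] that by auto
    have "\<phi> s0 + p * (h v - s0) - \<phi> (h v) \<le> 0"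
    proof (rule continuous_le_on_closure[of "{0..<v}" "\<lambda>w. \<phi> s0 + p * (h w - s0) - \<phi> (h w)"])
      show "continuous_on (closure {0..<v}) (\<lambda>w. \<phi> s0 + p * (h w - s0) - \<phi> (h w))"
        using continuous_on_subset[OF conth]
        by (intro continuous_intros) (auto simp: h_def intro!: continuous_intros)
      show "v \<in> closure {0..<v}" using v01 by simp
    qed (use below in auto)
    moreover have "\<phi> (h v) \<le> 0" using v(1) by (simp add: Z_def)
    ultimately have "\<phi> s0 + v * (p * (t - s0)) \<le> 0" by (simp add: h_def algebra_simps)
    moreover have "(1 - v) * \<phi> s0 \<ge> 0" using v01 pos0 by simp
    ultimately have "v * (\<phi> s0 + p * (t - s0)) \<le> 0" by (simp add: algebra_simps)
    then have "\<phi> s0 + p * (t - s0) \<le> 0" using v01 by (simp add: mult_le_0_iff)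
    then show ?thesis using nonneg[of t] by linarith
  qed (use p in auto)
  obtain j where j: "j \<in> J" using J by auto
  from convex_le_Inf_differential[OF G[OF j], of s0] obtain r
    where r: "\<And>t. G j s0 + r * (t - s0) \<le> G j t" by (metis UNIV_I interior_UNIV)
  have "(r + p) * s + (G j s0 + \<phi> s0 - (r + p) * s0) \<le> G j s + \<phi> s" for s
    using add_mono[OF r[of s] tangent[of s]] by (simp add: algebra_simps)
  then have "(r + p) * s0 + (G j s0 + \<phi> s0 - (r + p) * s0) \<le> G j s0"
    by (intro minor[OF j]) (simp add: \<phi>_def)
  then show False using pos0 by simp
qed

section \<open>Affine minorants of lower semicontinuous convex functions\<close>

lemma convex_epigraph:
  fixes f :: "real \<Rightarrow> ereal"
  assumes "convex_fun f"
  shows "convex {z :: real \<times> real. f (fst z) \<le> ereal (snd z)}"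
proof (rule convexI, clarsimp)
  fix x y a b u v :: real
  assume le: "f x \<le> ereal a" "f y \<le> ereal b" and uv: "0 \<le> u" "0 \<le> v" "u + v = 1"
  have "f (u *\<^sub>R x + v *\<^sub>R y) \<le> ereal u * f x + ereal v * f y"
    using assms uv unfolding convex_fun_def by blast
  also have "\<dots> \<le> ereal u * ereal a + ereal v * ereal b"
    using le uv by (intro add_mono ereal_mult_left_mono) auto
  finally show "f (u * x + v * y) \<le> ereal (u * a + v * b)" by simp
qed

lemma closed_epigraph:
  fixes f :: "real \<Rightarrow> ereal"
  assumes "lower_semicontinuous f"
  shows "closed {z :: real \<times> real. f (fst z) \<le> ereal (snd z)}"
proof -
  have "open {z :: real \<times> real. ereal (snd z) < f (fst z)}"
  proof (rule Topological_Spaces.openI)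
    fix z :: "real \<times> real"
    assume "z \<in> {z. ereal (snd z) < f (fst z)}"
    moreover obtain x b where z: "z = (x, b)" by (cases z)
    ultimately have "ereal b < f x" by simp
    then obtain c where c: "ereal b < ereal c" "ereal c < f x"
      using ereal_dense2 by blast
    have "ereal c < Liminf (at x) f"
      using c(2) assms unfolding lower_semicontinuous_def by (meson less_le_trans)
    then have "eventually (\<lambda>y. ereal c < f y) (at x)" by (rule less_LiminfD)
    then have "eventually (\<lambda>y. ereal c < f y) (nhds x)"
      unfolding eventually_at_filter by (rule eventually_mono) (use c(2) in auto)
    then obtain U where U: "open U" "x \<in> U" "\<forall>y\<in>U. ereal c < f y"
      by (auto simp: eventually_nhds)
    have "open (U \<times> {..<c})" using U by (intro open_Times) auto
    moreover have "z \<in> U \<times> {..<c}" using U c by (simp add: z)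
    moreover have "U \<times> {..<c} \<subseteq> {z. ereal (snd z) < f (fst z)}"
    proof clarsimp
      fix y d assume "y \<in> U" "d < c"
      then have "ereal d < ereal c" "ereal c < f y" using U by auto
      then show "ereal d < f y" by (rule less_trans)
    qed
    ultimately show "\<exists>T. open T \<and> z \<in> T \<and> T \<subseteq> {z. ereal (snd z) < f (fst z)}"
      by blast
  qed
  moreover have "- {z. f (fst z) \<le> ereal (snd z)} = {z. ereal (snd z) < f (fst z)}"
    by (auto simp: not_le)
  ultimately show ?thesis by (simp add: closed_def)
qed

text \<open>
  The Fenchel--Moreau theorem on the line: a point below the graph can be separated from the graph
  by an affine function. A vertical line separating the point from the epigraph is tilted with the
  help of a given affine minorant.
\<close>

lemma affine_minorant_above:
  fixes f :: "real \<Rightarrow> ereal"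
  assumes f: "f \<in> lsc_convex_funs" and minor: "\<And>x. ereal (A * x + B) \<le> f x"
    and r: "ereal r < f x0"
  shows "\<exists>p k. (\<forall>x. ereal (p * x + k) \<le> f x) \<and> r < p * x0 + k"
proof -
  define S where "S = {z :: real \<times> real. f (fst z) \<le> ereal (snd z)}"
  have "convex S" "closed S"
    using f convex_epigraph closed_epigraph by (auto simp: lsc_convex_funs_def S_def)
  moreover have "(x0, r) \<notin> S" using r by (simp add: S_def)
  ultimately obtain z \<beta> where z: "inner z (x0, r) < \<beta>" "\<forall>w\<in>S. inner z w > \<beta>"
    using separating_hyperplane_closed_point[of S "(x0, r)"] by blast
  obtain a b where ab: "z = (a, b)" by (cases z)
  have sep0: "a * x0 + b * r < \<beta>" using z(1) by (simp add: ab)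
  have sep: "\<beta> < a * x + b * y" if "f x \<le> ereal y" for x y
    using z(2) that by (auto simp: ab S_def)
  have fin: "\<exists>y. f x = ereal y" if "f x \<noteq> \<infinity>" for x
    using f that by (cases "f x") (auto simp: lsc_convex_funs_def proper_fun_def)
  obtain x1 y1 where xy1: "f x1 = ereal y1"
    using f fin unfolding lsc_convex_funs_def proper_fun_def by blast
  have "b \<ge> 0"
  proof (rule ccontr)
    assume "\<not> b \<ge> 0"
    then have b: "b < 0" by simp
    define y where "y = max y1 ((\<beta> - a * x1) / b)"
    have "(\<beta> - a * x1) / b \<le> y" by (simp add: y_def)
    then have "b * y \<le> \<beta> - a * x1" using b by (simp add: field_simps)
    moreover have "\<beta> < a * x1 + b * y" by (rule sep) (simp add: xy1 y_def)
    ultimately show False by simp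
  qed
  then consider "b > 0" | "b = 0" by linarith
  then show ?thesis
  proof cases
    case 1
    have "ereal (- a / b * x + \<beta> / b) \<le> f x" for x
    proof (cases "f x = \<infinity>")
      case False
      then obtain y where y: "f x = ereal y" using fin by blast
      then have "\<beta> < a * x + b * y" using sep by simp
      then show ?thesis using 1 y by (simp add: field_simps)
    qed simp
    moreover have "r < - a / b * x0 + \<beta> / b" using sep0 1 by (simp add: field_simps)
    ultimately show ?thesis by blast
  next
    case 2
    \<comment> \<open>The separating line is vertical: \<open>\<beta> - a * x\<close> is negative on the domain of \<open>f\<close> and positive
        at \<open>x0\<close>. A large multiple \<open>l\<close> of it is added to the given minorant.\<close>
    define g where "g = \<beta> - a * x0"
    have g: "g > 0" using sep0 2 by (simp add: g_def)
    define l where "l = (\<bar>r - (A * x0 + B)\<bar> + 1) / g"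
    have l: "l \<ge> 0" "l * g = \<bar>r - (A * x0 + B)\<bar> + 1" using g by (auto simp: l_def)
    have "ereal ((A - l * a) * x + (B + l * \<beta>)) \<le> f x" for x
    proof (cases "f x = \<infinity>")
      case False
      then obtain y where y: "f x = ereal y" using fin by blast
      then have "\<beta> - a * x \<le> 0" using sep[of x y] 2 by simp
      then have "l * (\<beta> - a * x) \<le> 0" using l by (simp add: mult_le_0_iff)
      moreover have "A * x + B \<le> y" using minor[of x] y by simp
      ultimately show ?thesis using y by (simp add: algebra_simps)
    qed simp
    moreover have "(A - l * a) * x0 + (B + l * \<beta>) = A * x0 + B + l * g"
      by (simp add: g_def algebra_simps)
    then have "r < (A - l * a) * x0 + (B + l * \<beta>)" using l by linarith
    ultimately show ?thesis by blast
  qed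
qed

section \<open>The conjugate of a function plus half the square\<close>

text \<open>
  \<open>quad_conj f\<close> is the Fenchel conjugate of \<open>x \<mapsto> f x + x\<^sup>2 / 2\<close>. The supremum is taken over the domain
  of \<open>f\<close> in the reals; it is meaningful if \<open>f\<close> is proper and has an affine minorant, so that the
  set of values is nonempty and bounded above.
\<close>

definition quad_conj :: "(real \<Rightarrow> ereal) \<Rightarrow> real \<Rightarrow> real" where
  "quad_conj f s = (SUP x\<in>{x. f x \<noteq> \<infinity>}. s * x - real_of_ereal (f x) - x\<^sup>2 / 2)"

lemma linear_minus_half_square_le: "a * x - x\<^sup>2 / 2 \<le> a\<^sup>2 / 2" for a x :: real
  using zero_le_power2[of "a - x"] by (simp add: power2_eq_square algebra_simps)

context
  fixes f :: "real \<Rightarrow> ereal" and A B :: real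
  assumes f: "proper_fun f" and minor: "\<And>x. ereal (A * x + B) \<le> f x"
begin

lemma quad_conj_le:
  assumes "\<And>x r. f x = ereal r \<Longrightarrow> s * x - r - x\<^sup>2 / 2 \<le> b"
  shows "quad_conj f s \<le> b"
  unfolding quad_conj_def
proof (rule cSUP_least)
  show "{x. f x \<noteq> \<infinity>} \<noteq> {}" using f by (auto simp: proper_fun_def)
  fix x assume "x \<in> {x. f x \<noteq> \<infinity>}"
  then have "f x = ereal (real_of_ereal (f x))"
    using f by (auto simp: proper_fun_def ereal_real)
  then show "s * x - real_of_ereal (f x) - x\<^sup>2 / 2 \<le> b" by (rule assms)
qed

lemma le_quad_conj:
  assumes "f x = ereal r"
  shows "s * x - r - x\<^sup>2 / 2 \<le> quad_conj f s"
proof -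
  have "bdd_above ((\<lambda>x. s * x - real_of_ereal (f x) - x\<^sup>2 / 2) ` {x. f x \<noteq> \<infinity>})"
  proof (rule bdd_aboveI2)
    fix x assume "x \<in> {x. f x \<noteq> \<infinity>}"
    then have "A * x + B \<le> real_of_ereal (f x)"
      using f minor[of x] by (cases "f x") (auto simp: proper_fun_def)
    then show "s * x - real_of_ereal (f x) - x\<^sup>2 / 2 \<le> (s - A)\<^sup>2 / 2 - B"
      using linear_minus_half_square_le[of "s - A" x] by (simp add: algebra_simps)
  qed
  from cSUP_upper[OF _ this, of x] show ?thesis
    using assms by (simp add: quad_conj_def)
qed

lemma quad_conj_approx:
  assumes "\<epsilon> > 0"
  shows "\<exists>x r. f x = ereal r \<and> quad_conj f s - \<epsilon> < s * x - r - x\<^sup>2 / 2"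
proof (rule ccontr)
  assume "\<not> ?thesis"
  then have "quad_conj f s \<le> quad_conj f s - \<epsilon>" by (intro quad_conj_le) (auto simp: not_less)
  then show False using assms by simp
qed

lemma convex_quad_conj: "convex_on UNIV (quad_conj f)"
proof (rule convex_onI)
  fix u s t :: real
  assume u: "0 < u" "u < 1"
  have "quad_conj f ((1 - u) * s + u * t) \<le> (1 - u) * quad_conj f s + u * quad_conj f t"
  proof (rule quad_conj_le)
    fix x r assume "f x = ereal r"
    from le_quad_conj[OF this]
    have "(1 - u) * (s * x - r - x\<^sup>2 / 2) + u * (t * x - r - x\<^sup>2 / 2)
        \<le> (1 - u) * quad_conj f s + u * quad_conj f t"
      using u by (intro add_mono mult_left_mono) auto
    then show "((1 - u) * s + u * t) * x - r - x\<^sup>2 / 2 \<le> (1 - u) * quad_conj f s + u * quad_conj f t"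
      by (simp add: algebra_simps diff_divide_distrib)
  qed
  then show "quad_conj f ((1 - u) *\<^sub>R s + u *\<^sub>R t) \<le> (1 - u) * quad_conj f s + u * quad_conj f t"
    by simp
qed auto

text \<open>
  The function \<open>s \<mapsto> s\<^sup>2 / 2 - quad_conj f s\<close> is the Moreau envelope of \<open>f\<close>, the infimum over \<open>x\<close> of
  \<open>f x + (x - s)\<^sup>2 / 2\<close>; it is convex since that expression is jointly convex in \<open>x\<close> and \<open>s\<close>.
\<close>

lemma convex_half_square_minus_quad_conj:
  assumes "convex_fun f"
  shows "convex_on UNIV (\<lambda>s. s\<^sup>2 / 2 - quad_conj f s)"
proof (rule convex_onI)
  fix u s t :: real
  assume u: "0 < u" "u < 1"
  define w where "w = (1 - u) * s + u * t"
  have "w\<^sup>2 / 2 - quad_conj f w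
      \<le> (1 - u) * (s\<^sup>2 / 2 - quad_conj f s) + u * (t\<^sup>2 / 2 - quad_conj f t)"
  proof (rule field_le_epsilon)
    fix \<epsilon> :: real assume \<epsilon>: "\<epsilon> > 0"
    obtain x a where x: "f x = ereal a" "quad_conj f s - \<epsilon> < s * x - a - x\<^sup>2 / 2"
      using quad_conj_approx[OF \<epsilon>] by blast
    obtain y b where y: "f y = ereal b" "quad_conj f t - \<epsilon> < t * y - b - y\<^sup>2 / 2"
      using quad_conj_approx[OF \<epsilon>] by blast
    define z where "z = (1 - u) * x + u * y"
    have "f ((1 - u) *\<^sub>R x + u *\<^sub>R y) \<le> ereal (1 - u) * f x + ereal u * f y"
      using assms u unfolding convex_fun_def by (simp del: real_scaleR_def)
    then have "f z \<le> ereal ((1 - u) * a + u * b)" by (simp add: z_def x y)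
    moreover have "f z \<noteq> -\<infinity>" using f by (simp add: proper_fun_def)
    ultimately obtain c where c: "f z = ereal c" "c \<le> (1 - u) * a + u * b"
      by (cases "f z") auto
    have "w\<^sup>2 / 2 - quad_conj f w \<le> c + (z - w)\<^sup>2 / 2"
      using le_quad_conj[OF c(1), of w]
      by (simp add: power2_eq_square algebra_simps add_divide_distrib diff_divide_distrib)
    also have "(z - w)\<^sup>2 \<le> (1 - u) * (x - s)\<^sup>2 + u * (y - t)\<^sup>2"
    proof -
      have "(1 - u) * (x - s)\<^sup>2 + u * (y - t)\<^sup>2 - (z - w)\<^sup>2 = (1 - u) * u * ((x - s) - (y - t))\<^sup>2"
        by (simp add: z_def w_def power2_eq_square algebra_simps)
      also have "\<dots> \<ge> 0" using u by simp
      finally show ?thesis by simp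
    qed
    finally have 1: "w\<^sup>2 / 2 - quad_conj f w
        \<le> (1 - u) * (a + (x - s)\<^sup>2 / 2) + u * (b + (y - t)\<^sup>2 / 2)"
      using c(2) by (simp add: algebra_simps add_divide_distrib diff_divide_distrib)
    have "a + (x - s)\<^sup>2 / 2 \<le> s\<^sup>2 / 2 - quad_conj f s + \<epsilon>"
      using x(2)
      by (simp add: power2_eq_square algebra_simps add_divide_distrib diff_divide_distrib)
    moreover have "b + (y - t)\<^sup>2 / 2 \<le> t\<^sup>2 / 2 - quad_conj f t + \<epsilon>"
      using y(2)
      by (simp add: power2_eq_square algebra_simps add_divide_distrib diff_divide_distrib)
    ultimately have "(1 - u) * (a + (x - s)\<^sup>2 / 2) + u * (b + (y - t)\<^sup>2 / 2)
       \<le> (1 - u) * (s\<^sup>2 / 2 - quad_conj f s + \<epsilon>) + u * (t\<^sup>2 / 2 - quad_conj f t + \<epsilon>)"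
      using u by (intro add_mono[OF mult_left_mono mult_left_mono]) auto
    then show "w\<^sup>2 / 2 - quad_conj f w
      \<le> (1 - u) * (s\<^sup>2 / 2 - quad_conj f s) + u * (t\<^sup>2 / 2 - quad_conj f t) + \<epsilon>"
      using 1 by (simp add: algebra_simps)
  qed
  then show "((1 - u) *\<^sub>R s + u *\<^sub>R t)\<^sup>2 / 2 - quad_conj f ((1 - u) *\<^sub>R s + u *\<^sub>R t)
      \<le> (1 - u) * (s\<^sup>2 / 2 - quad_conj f s) + u * (t\<^sup>2 / 2 - quad_conj f t)"
    by (simp add: w_def)
qed auto

end

section \<open>The multi-marginal cost and its conjugates on the line\<close>

lemma mm_cost_real:
  fixes x :: "nat \<Rightarrow> real"
  shows "mm_cost N x = ((\<Sum>j\<in>{1..N}. x j)\<^sup>2 - (\<Sum>j\<in>{1..N}. (x j)\<^sup>2)) / 2"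
proof (induction N)
  case 0
  have "{(i, j). 1 \<le> i \<and> i < j \<and> j \<le> (0::nat)} = {}" by auto
  then show ?case by (simp only: mm_cost_def) simp
next
  case (Suc N)
  let ?P = "{(i, j). 1 \<le> i \<and> i < j \<and> j \<le> N}"
  have fin: "finite ?P" by (rule finite_subset[of _ "{1..N} \<times> {1..N}"]) auto
  have "{(i, j). 1 \<le> i \<and> i < j \<and> j \<le> Suc N} = ?P \<union> (\<lambda>i. (i, Suc N)) ` {1..N}"
    by (auto simp: le_Suc_eq)
  moreover have "?P \<inter> (\<lambda>i. (i, Suc N)) ` {1..N} = {}" by auto
  ultimately have "mm_cost (Suc N) x
      = mm_cost N x + (\<Sum>(i, j)\<in>(\<lambda>i. (i, Suc N)) ` {1..N}. x i \<bullet> x j)"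
    unfolding mm_cost_def using fin by (simp add: sum.union_disjoint)
  also have "(\<Sum>(i, j)\<in>(\<lambda>i. (i, Suc N)) ` {1..N}. x i \<bullet> x j) = (\<Sum>i\<in>{1..N}. x i) * x (Suc N)"
    by (subst sum.reindex) (auto simp: inj_on_def sum_distrib_right)
  finally show ?case
    by (simp add: Suc.IH power2_eq_square algebra_simps add_divide_distrib diff_divide_distrib)
qed

lemma c_conj_except_ge:
  assumes "x i = t" and "\<And>j. j \<in> {1..N} - {i} \<Longrightarrow> f j (x j) = ereal (r j)"
  shows "ereal (mm_cost N x - (\<Sum>j\<in>{1..N}-{i}. r j)) \<le> c_conj_except N f i t"
proof -
  have "ereal (mm_cost N x - (\<Sum>j\<in>{1..N}-{i}. r j))
      = ereal (mm_cost N x) - (\<Sum>j\<in>{1..N}-{i}. f j (x j))"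
    using assms(2) by simp
  also have "\<dots> \<le> c_conj_except N f i t"
    unfolding c_conj_except_def by (rule SUP_upper) (simp add: assms(1))
  finally show ?thesis .
qed

lemma c_conj_except_le:
  assumes f: "\<And>j. j \<in> {1..N} - {i} \<Longrightarrow> proper_fun (f j)"
    and le: "\<And>x r. x i = t \<Longrightarrow> (\<And>j. j \<in> {1..N} - {i} \<Longrightarrow> f j (x j) = ereal (r j))
               \<Longrightarrow> mm_cost N x - (\<Sum>j\<in>{1..N}-{i}. r j) \<le> b"
  shows "c_conj_except N f i t \<le> ereal b"
  unfolding c_conj_except_def
proof (rule SUP_least)
  fix x assume x: "x \<in> {x. x i = t}"
  show "ereal (mm_cost N x) - (\<Sum>j\<in>{1..N}-{i}. f j (x j)) \<le> ereal b"
  proof (cases "\<exists>j\<in>{1..N}-{i}. f j (x j) = \<infinity>")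
    case True
    then have "(\<Sum>j\<in>{1..N}-{i}. f j (x j)) = \<infinity>" by (subst sum_Pinfty) auto
    then show ?thesis by simp
  next
    case False
    define r where "r j = real_of_ereal (f j (x j))" for j
    have r: "f j (x j) = ereal (r j)" if "j \<in> {1..N} - {i}" for j
      using f[OF that] False that by (auto simp: proper_fun_def r_def ereal_real)
    then have "ereal (mm_cost N x) - (\<Sum>j\<in>{1..N}-{i}. f j (x j))
        = ereal (mm_cost N x - (\<Sum>j\<in>{1..N}-{i}. r j))" by simp
    also have "\<dots> \<le> ereal b" using le[of x r] x r by simp
    finally show ?thesis .
  qed
qed

text \<open>
  Freezing all the coordinates but one in the inequality between the cost and the sum gives an
  affine minorant, because the cost is affine in each coordinate.
\<close>

lemma affine_minorant_if_cost_le_sum: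
  fixes f :: "nat \<Rightarrow> real \<Rightarrow> ereal"
  assumes f: "\<And>j. j \<in> {1..N} \<Longrightarrow> proper_fun (f j)" and i: "i \<in> {1..N}"
    and le: "\<And>x r. (\<And>j. j \<in> {1..N} \<Longrightarrow> f j (x j) = ereal (r j))
                \<Longrightarrow> mm_cost N x \<le> (\<Sum>j\<in>{1..N}. r j)"
  shows "\<exists>A B. \<forall>x. ereal (A * x + B) \<le> f i x"
proof -
  have "\<forall>j\<in>{1..N}. \<exists>y \<rho>. f j y = ereal \<rho>"
    using f unfolding proper_fun_def by (metis ereal_cases)
  then obtain y \<rho> where y: "\<And>j. j \<in> {1..N} \<Longrightarrow> f j (y j) = ereal (\<rho> j)" by metis
  define Y where "Y = (\<Sum>j\<in>{1..N}-{i}. y j)"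
  define Z where "Z = (\<Sum>j\<in>{1..N}-{i}. (y j)\<^sup>2)"
  define R where "R = (\<Sum>j\<in>{1..N}-{i}. \<rho> j)"
  have "ereal (Y * x + ((Y\<^sup>2 - Z) / 2 - R)) \<le> f i x" for x
  proof (cases "f i x")
    case (real r)
    have "mm_cost N (y(i := x)) \<le> (\<Sum>j\<in>{1..N}. (\<rho>(i := r)) j)"
      by (rule le) (auto simp: y real)
    also have "\<dots> = r + R"
      using i by (simp add: sum.remove[of _ i] R_def)
    also have "mm_cost N (y(i := x)) = ((x + Y)\<^sup>2 - (x\<^sup>2 + Z)) / 2"
      unfolding mm_cost_real using i by (simp add: sum.remove[of _ i] Y_def Z_def)
    finally show ?thesis
      by (simp add: real power2_eq_square algebra_simps add_divide_distrib diff_divide_distrib)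
  qed (use f[OF i] in \<open>auto simp: proper_fun_def\<close>)
  then show ?thesis by blast
qed

section \<open>Cyclic involutivity\<close>

lemma N_cyclically_involutive_lsc_convex_funs_real:
  assumes N: "N \<ge> 2"
  shows "N_cyclically_involutive N (lsc_convex_funs :: (real \<Rightarrow> ereal) set)"
  unfolding N_cyclically_involutive_def
proof (intro allI impI)
  fix f :: "nat \<Rightarrow> real \<Rightarrow> ereal" and t :: real
  assume f: "\<forall>i\<in>{1..N}. f i \<in> lsc_convex_funs"
    and eq: "\<forall>i\<in>{2..N}. \<forall>t. f i t = c_conj_except N f i t"
  have proper: "proper_fun (f j)" if "j \<in> {1..N}" for j
    using f that by (simp add: lsc_convex_funs_def)
  have remove: "(\<Sum>i\<in>{1..N}. h i) = h j + (\<Sum>i\<in>{1..N}-{j}. h i)"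
    if "j \<in> {1..N}" for h :: "nat \<Rightarrow> real" and j
    using that by (intro sum.remove) auto
  have rest: "{1..N} - {1} = {2..N}" by auto
  have sum1: "(\<Sum>j\<in>{1..N}. h j) = h 1 + (\<Sum>j\<in>{2..N}. h j)" for h :: "nat \<Rightarrow> real"
    using remove[of 1 h] N unfolding rest by simp
  have cost_le: "mm_cost N x \<le> (\<Sum>j\<in>{1..N}. r j)"
    if r: "\<And>j. j \<in> {1..N} \<Longrightarrow> f j (x j) = ereal (r j)" for x r
  proof -
    have "ereal (mm_cost N x - (\<Sum>j\<in>{1..N}-{2}. r j)) \<le> f 2 (x 2)"
      using c_conj_except_ge[of x 2 "x 2" N f r] r eq N by simp
    then show ?thesis using r[of 2] remove[of 2 r] N by simp
  qed
  have "\<forall>i\<in>{1..N}. \<exists>A B. \<forall>x. ereal (A * x + B) \<le> f i x"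
    using affine_minorant_if_cost_le_sum[of N f, OF proper _ cost_le] by blast
  then obtain A B where minor: "\<And>i x. i \<in> {1..N} \<Longrightarrow> ereal (A i * x + B i) \<le> f i x" by metis
  define Q where "Q i = quad_conj (f i)" for i
  have young: "s * x - r - x\<^sup>2 / 2 \<le> Q i s" if "i \<in> {1..N}" "f i x = ereal r" for i x r s
    unfolding Q_def using le_quad_conj[OF proper minor] that by blast
  have approx: "\<exists>x r. f i x = ereal r \<and> Q i s - \<epsilon> < s * x - r - x\<^sup>2 / 2"
    if "i \<in> {1..N}" "\<epsilon> > 0" for i s \<epsilon>
    unfolding Q_def using quad_conj_approx[OF proper minor] that by blast
  \<comment> \<open>The cost inequality in terms of the conjugates, using the identity \<open>mm_cost_real\<close>.\<close>
  have Q_sum_le: "(\<Sum>j\<in>{1..N}. Q j s) \<le> s\<^sup>2 / 2" for s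
  proof (rule field_le_epsilon)
    fix \<epsilon> :: real assume \<epsilon>: "\<epsilon> > 0"
    have "\<forall>j\<in>{1..N}. \<exists>x r. f j x = ereal r \<and> Q j s - \<epsilon> / N < s * x - r - x\<^sup>2 / 2"
      using approx \<epsilon> N by simp
    then obtain x r where xr: "\<And>j. j \<in> {1..N} \<Longrightarrow> f j (x j) = ereal (r j)"
        "\<And>j. j \<in> {1..N} \<Longrightarrow> Q j s - \<epsilon> / N < s * x j - r j - (x j)\<^sup>2 / 2" by metis
    define S where "S = (\<Sum>j\<in>{1..N}. x j)"
    have "(\<Sum>j\<in>{1..N}. Q j s - \<epsilon> / N) \<le> (\<Sum>j\<in>{1..N}. s * x j - r j - (x j)\<^sup>2 / 2)"
      using xr(2) by (intro sum_mono less_imp_le)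
    then have "(\<Sum>j\<in>{1..N}. Q j s) - \<epsilon>
        \<le> s * S - (\<Sum>j\<in>{1..N}. r j) - (\<Sum>j\<in>{1..N}. (x j)\<^sup>2) / 2"
      using N by (simp add: sum_subtractf S_def sum_distrib_left sum_divide_distrib)
    also have "\<dots> \<le> s * S - S\<^sup>2 / 2"
      using cost_le[OF xr(1)] by (simp add: mm_cost_real S_def diff_divide_distrib)
    also have "\<dots> \<le> s\<^sup>2 / 2" by (rule linear_minus_half_square_le)
    finally show "(\<Sum>j\<in>{1..N}. Q j s) \<le> s\<^sup>2 / 2 + \<epsilon>" by simp
  qed

  \<comment> \<open>The vanishing of the gap, by the conjugacy equations for the indices \<open>j \<ge> 2\<close>.\<close>
  have "s\<^sup>2 / 2 - Q 1 s = (\<Sum>j\<in>{2..N}. Q j s)" for s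
  proof (rule gap_vanishes)
    show "convex_on UNIV (\<lambda>s. s\<^sup>2 / 2 - Q 1 s)"
      unfolding Q_def using f N
      by (intro convex_half_square_minus_quad_conj[OF proper minor]) (auto simp: lsc_convex_funs_def)
    show "convex_on UNIV (Q j)" if "j \<in> {2..N}" for j
      unfolding Q_def using that by (intro convex_quad_conj[OF proper minor]) auto
    show "(\<Sum>j\<in>{2..N}. Q j s) \<le> s\<^sup>2 / 2 - Q 1 s" for s
      using Q_sum_le[of s] unfolding sum1 by simp
    fix j m k s
    assume j: "j \<in> {2..N}"
      and below: "\<And>s. m * s + k \<le> Q j s + (s\<^sup>2 / 2 - Q 1 s - (\<Sum>j\<in>{2..N}. Q j s))"
    have le: "m * s + k \<le> s\<^sup>2 / 2 - (\<Sum>i\<in>{1..N}-{j}. Q i s)" for s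
      using below[of s] sum1[of "\<lambda>i. Q i s"] remove[of j "\<lambda>i. Q i s"] j by force
    \<comment> \<open>An affine minorant of slope \<open>m\<close> of the gap plus \<open>Q j\<close> bounds \<open>f j\<close> at the point \<open>m\<close>.\<close>
    have "c_conj_except N f j m \<le> ereal (- k - m\<^sup>2 / 2)"
    proof (rule c_conj_except_le)
      fix x r
      assume x: "x j = m" and r: "\<And>i. i \<in> {1..N} - {j} \<Longrightarrow> f i (x i) = ereal (r i)"
      define S where "S = (\<Sum>i\<in>{1..N}. x i)"
      have S: "S = m + (\<Sum>i\<in>{1..N}-{j}. x i)"
        using remove[of j x] j x by (simp add: S_def)
      have cost: "mm_cost N x = (S\<^sup>2 - m\<^sup>2 - (\<Sum>i\<in>{1..N}-{j}. (x i)\<^sup>2)) / 2"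
        unfolding mm_cost_real S_def[symmetric]
        using remove[of j "\<lambda>i. (x i)\<^sup>2"] j x by simp
      have "(\<Sum>i\<in>{1..N}-{j}. S * x i - r i - (x i)\<^sup>2 / 2) \<le> (\<Sum>i\<in>{1..N}-{j}. Q i S)"
        using young r by (intro sum_mono) auto
      then have "S * (S - m) - (\<Sum>i\<in>{1..N}-{j}. r i) - (\<Sum>i\<in>{1..N}-{j}. (x i)\<^sup>2) / 2
          \<le> (\<Sum>i\<in>{1..N}-{j}. Q i S)"
        by (simp add: S sum_subtractf sum_distrib_left sum_divide_distrib)
      then have "mm_cost N x - (\<Sum>i\<in>{1..N}-{j}. r i)
          \<le> (\<Sum>i\<in>{1..N}-{j}. Q i S) + (S\<^sup>2 - m\<^sup>2) / 2 - S * (S - m)"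
        by (simp add: cost diff_divide_distrib)
      also have "\<dots> \<le> - k - m\<^sup>2 / 2"
        using le[of S] by (simp add: power2_eq_square algebra_simps diff_divide_distrib)
      finally show "mm_cost N x - (\<Sum>i\<in>{1..N}-{j}. r i) \<le> - k - m\<^sup>2 / 2" .
    qed (use proper in auto)
    then have "f j m \<le> ereal (- k - m\<^sup>2 / 2)" using eq j by simp
    moreover have "f j m \<noteq> -\<infinity>" using proper[of j] j by (simp add: proper_fun_def)
    ultimately obtain r where r: "f j m = ereal r" "r \<le> - k - m\<^sup>2 / 2" by (cases "f j m") auto
    have "s * m - r - m\<^sup>2 / 2 \<le> Q j s" using young[OF _ r(1)] j by simp
    then show "m * s + k \<le> Q j s" using r(2) by (simp add: algebra_simps)
  qed (use N in auto)
  then have Q_sum: "(\<Sum>j\<in>{2..N}. Q j s) = s\<^sup>2 / 2 - Q 1 s" for s by simp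

  show "f 1 t = c_conj_except N f 1 t"
  proof (rule antisym)
    show "c_conj_except N f 1 t \<le> f 1 t"
    proof (cases "f 1 t")
      case (real r1)
      have "c_conj_except N f 1 t \<le> ereal r1"
      proof (rule c_conj_except_le)
        fix x r
        assume x: "x 1 = t" and r: "\<And>i. i \<in> {1..N} - {1} \<Longrightarrow> f i (x i) = ereal (r i)"
        have "mm_cost N x \<le> (\<Sum>j\<in>{1..N}. (r(1 := r1)) j)"
          using x r real by (intro cost_le) auto
        also have "\<dots> = r1 + (\<Sum>j\<in>{2..N}. r j)"
          unfolding sum1 by (auto intro!: sum.cong)
        finally show "mm_cost N x - (\<Sum>j\<in>{1..N}-{1}. r j) \<le> r1"
          unfolding rest by simp
      qed (use proper in auto)
      then show ?thesis unfolding real .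
    qed (use proper[of 1] N in \<open>auto simp: proper_fun_def\<close>)
    show "f 1 t \<le> c_conj_except N f 1 t"
    proof (rule ccontr)
      assume "\<not> f 1 t \<le> c_conj_except N f 1 t"
      then obtain \<gamma> where \<gamma>: "c_conj_except N f 1 t < ereal \<gamma>" "ereal \<gamma> < f 1 t"
        using ereal_dense2 by (meson not_le)
      have "1 \<in> {1..N}" using N by simp
      then obtain p k where pk: "\<And>x. ereal (p * x + k) \<le> f 1 x" "\<gamma> < p * t + k"
        using affine_minorant_above[OF _ minor \<gamma>(2)] f by blast
      \<comment> \<open>The function \<open>x \<mapsto> f 1 x + x\<^sup>2 / 2\<close> has an affine minorant of slope \<open>p + t\<close>, the sum of
          those of its two terms; the term \<open>x\<^sup>2 / 2\<close> contributes its tangent at \<open>t\<close>.\<close>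
      define s where "s = p + t"
      define \<epsilon> where "\<epsilon> = p * t + k - \<gamma>"
      have \<epsilon>: "\<epsilon> > 0" using pk(2) by (simp add: \<epsilon>_def)
      have Q1: "Q 1 s \<le> t\<^sup>2 / 2 - k"
        unfolding Q_def
      proof (rule quad_conj_le[OF proper minor])
        fix x r assume "f 1 x = ereal r"
        then have "p * x + k \<le> r" using pk(1)[of x] by simp
        then show "s * x - r - x\<^sup>2 / 2 \<le> t\<^sup>2 / 2 - k"
          using linear_minus_half_square_le[of t x] by (simp add: s_def algebra_simps)
      qed (use N in auto)
      have "\<forall>j\<in>{2..N}. \<exists>x r. f j x = ereal r \<and> Q j s - \<epsilon> / N < s * x - r - x\<^sup>2 / 2"
        using approx \<epsilon> N by simp
      then obtain y r where yr: "\<And>j. j \<in> {2..N} \<Longrightarrow> f j (y j) = ereal (r j)"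
          "\<And>j. j \<in> {2..N} \<Longrightarrow> Q j s - \<epsilon> / N < s * y j - r j - (y j)\<^sup>2 / 2" by metis
      define x where "x = y(1 := t)"
      define Y where "Y = (\<Sum>j\<in>{2..N}. y j)"
      have x: "(\<Sum>j\<in>{2..N}. h (x j)) = (\<Sum>j\<in>{2..N}. h (y j))" for h :: "real \<Rightarrow> real"
        by (rule sum.cong) (auto simp: x_def)
      have cost: "mm_cost N x = ((t + Y)\<^sup>2 - (t\<^sup>2 + (\<Sum>j\<in>{2..N}. (y j)\<^sup>2))) / 2"
        unfolding mm_cost_real sum1 x[of "\<lambda>u. u"] x[of "\<lambda>u. u\<^sup>2"] Y_def by (simp add: x_def)
      have "(\<Sum>j\<in>{2..N}. Q j s - \<epsilon> / N) \<le> (\<Sum>j\<in>{2..N}. s * y j - r j - (y j)\<^sup>2 / 2)"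
        using yr(2) by (intro sum_mono less_imp_le)
      then have "(\<Sum>j\<in>{2..N}. Q j s) - real (N - 1) * (\<epsilon> / N)
          \<le> s * Y - (\<Sum>j\<in>{2..N}. r j) - (\<Sum>j\<in>{2..N}. (y j)\<^sup>2) / 2"
        by (simp add: sum_subtractf Y_def sum_distrib_left sum_divide_distrib)
      moreover have "real (N - 1) * (\<epsilon> / N) \<le> \<epsilon>"
      proof -
        have "real (N - 1) * \<epsilon> \<le> real N * \<epsilon>" using \<epsilon> by (intro mult_right_mono) auto
        then show ?thesis using N by (simp add: field_simps)
      qed
      ultimately have "s\<^sup>2 / 2 - (t\<^sup>2 / 2 - k) - \<epsilon>
          \<le> s * Y - (\<Sum>j\<in>{2..N}. r j) - (\<Sum>j\<in>{2..N}. (y j)\<^sup>2) / 2"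
        using Q1 Q_sum[of s] by linarith
      moreover have "0 \<le> (t + Y - s)\<^sup>2 / 2" by simp
      ultimately have "\<gamma> \<le> mm_cost N x - (\<Sum>j\<in>{2..N}. r j)"
        unfolding cost \<epsilon>_def
        by (simp add: s_def power2_eq_square algebra_simps add_divide_distrib diff_divide_distrib)
      also have "ereal \<dots> \<le> c_conj_except N f 1 t"
        using c_conj_except_ge[of x 1 t N f r, unfolded rest] yr(1) by (simp add: x_def)
      finally show False using \<gamma>(1) by simp
    qed
  qed
qed

theorem theorem1p7:
  shows "cyclically_involutive (lsc_convex_funs :: (real \<Rightarrow> ereal) set)"
  by (simp add: cyclically_involutive_def N_cyclically_involutive_lsc_convex_funs_real)

end
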